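(* Let $K$ be a number field containing $\mathbb{Q}[i]$, let $F:=(f_1,\ldots,f_n)$ be a sequence of polynomials in $K[X_1,\ldots,X_n]$, and let $\zeta\in K^n$ be a zero of $F$ (i.e. $f_1(\zeta)=\cdots=f_n(\zeta)=0$) which is smooth, i.e. the Jacobian matrix $DF(\zeta)$ lies in $GL(n,K)$. Let $|\cdot|_\nu: K\to\mathbb{R}_+$, $\nu\in M_K$, be an absolute value on $K$ (archimedean or non-archimedean). Then every $z\in K^n$ satisfying $$\|\zeta-z\|_\nu\,\gamma_\nu(F,\zeta)\le \frac{3-\sqrt 7}{2}$$ is an approximate zero of the system $F$ with associate zero $\zeta$ with respect to the absolute value $|\cdot|_\nu$.
   Context: $M_K$ is the standard proper set of absolute values on $K$ (one for each place, extending the usual or a $p$-adic absolute value of $\mathbb{Q}$), satisfying the product formula with the usual multiplicities. For $\nu\in M_K$, $K_\nu$ is the completion of $K$ with respect to $|\cdot|_\nu$, and $\|\cdot\|_\nu$ is the associated norm on $K_\nu^n$: the Hermitian norm if $\nu$ is archimedean, the maximum norm if $\nu$ is non-archimedean. Norms of multilinear operators are the operator norms with respect to $\|\cdot\|_\nu$. The quantity $\gamma$ is $$\gamma_{\nu}(F,\zeta):=\sup_{k\ge 2}\left\|\frac{DF(\zeta)^{-1}D^{(k)}F(\zeta)}{k!}\right\|_{\nu}^{\frac{1}{k-1}},$$ where $DF(\zeta)^{-1}D^{(k)}F(\zeta):(K_\nu^n)^k\to K_\nu^n$ is viewed as a $k$-multilinear operator. The Newton operator is $N_F(X):=X-DF(X)^{-1}F(X)$.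 A point $z\in K^n$ is an approximate zero of $F$ with associate (smooth) zero $\zeta\in K^n$ with respect to $|\cdot|_\nu$ if: (1) $DF(z)\in GL(n,K)$; (2) the sequence $z_1:=N_F(z)$, $z_k:=N_F(z_{k-1})$ for $k\ge 2$, is well-defined; (3) for every integer $k\ge 1$, $\|z_k-\zeta\|_\nu\le \frac{1}{2^{2^{k-1}}}\|z-\zeta\|_\nu$. *)

theory Defs
  imports
    "HOL-Analysis.Analysis"
    "HOL-Library.Poly_Mapping"
    "HOL-Computational_Algebra.Primes"
begin

type_synonym ('n, 'k) mpoly = "('n \<Rightarrow>\<^sub>0 nat) \<Rightarrow>\<^sub>0 'k"

definition mpoly_eval :: "('n::finite, 'k::field) mpoly \<Rightarrow> 'k ^ 'n \<Rightarrow> 'k" where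
  "mpoly_eval p x =
     (\<Sum>m\<in>Poly_Mapping.keys p. Poly_Mapping.lookup p m * (\<Prod>i\<in>UNIV. x $ i ^ Poly_Mapping.lookup m i))"

text \<open>Formal partial derivative. The truncated subtraction of exponents is harmless: where it
  truncates, the coefficient vanishes.\<close>

definition mpoly_pderiv :: "'n::finite \<Rightarrow> ('n, 'k::field) mpoly \<Rightarrow> ('n, 'k) mpoly" where
  "mpoly_pderiv j p =
     (\<Sum>m\<in>Poly_Mapping.keys p. Poly_Mapping.single (m - Poly_Mapping.single j 1)
        (of_nat (Poly_Mapping.lookup m j) * Poly_Mapping.lookup p m))"

definition system_eval :: "('n::finite, 'k::field) mpoly ^ 'n \<Rightarrow> 'k ^ 'n \<Rightarrow> 'k ^ 'n" where
  "system_eval F x = (\<chi> i. mpoly_eval (F $ i) x)"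

definition jacobian :: "('n::finite, 'k::field) mpoly ^ 'n \<Rightarrow> 'k ^ 'n \<Rightarrow> 'k ^ 'n ^ 'n" where
  "jacobian F x = (\<chi> i j. mpoly_eval (mpoly_pderiv j (F $ i)) x)"

text \<open>The \<open>k\<close>-th derivative at \<open>x\<close>, as a \<open>k\<close>-multilinear operator applied to the \<open>k\<close>-tuple of
  vectors \<open>hs\<close>; the order \<open>k\<close> is the length of \<open>hs\<close>.\<close>

definition higher_deriv ::
    "('n::finite, 'k::field) mpoly ^ 'n \<Rightarrow> 'k ^ 'n \<Rightarrow> ('k ^ 'n) list \<Rightarrow> 'k ^ 'n" where
  "higher_deriv F x hs =
     (\<chi> i. \<Sum>js | length js = length hs.
        mpoly_eval (foldr mpoly_pderiv js (F $ i)) x * (\<Prod>l<length hs. (hs ! l) $ (js ! l)))"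

definition number_field :: "'k::field_char_0 itself \<Rightarrow> bool" where
  "number_field _ \<longleftrightarrow>
     (\<exists>B. finite_dimensional_vector_space (\<lambda>(q::rat) (x::'k). of_rat q * x) B)"

definition absolute_value :: "('k::field \<Rightarrow> real) \<Rightarrow> bool" where
  "absolute_value v \<longleftrightarrow>
     (\<forall>x. 0 \<le> v x) \<and> (\<forall>x. v x = 0 \<longleftrightarrow> x = 0) \<and>
     (\<forall>x y. v (x * y) = v x * v y) \<and> (\<forall>x y. v (x + y) \<le> v x + v y)"

definition non_archimedean :: "('k::field \<Rightarrow> real) \<Rightarrow> bool" where
  "non_archimedean v \<longleftrightarrow> (\<forall>x y. v (x + y) \<le> max (v x) (v y))"

definition padic_abs :: "nat \<Rightarrow> rat \<Rightarrow> real" where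
  "padic_abs p q =
     (if q = 0 then 0
      else real p powi (int (multiplicity (int p) (snd (quotient_of q)))
                      - int (multiplicity (int p) (fst (quotient_of q)))))"

text \<open>The set \<open>M\<^sub>K\<close>. Every place contains exactly one absolute value with this normalization.\<close>

definition standard_absolute_values :: "('k::field_char_0 \<Rightarrow> real) set" where
  "standard_absolute_values =
     {v. absolute_value v \<and>
         ((\<forall>q. v (of_rat q) = \<bar>of_rat q\<bar>) \<or>
          (\<exists>p. prime p \<and> (\<forall>q. v (of_rat q) = padic_abs p q)))}"

text \<open>The field \<open>'c\<close> with the absolute value \<open>w\<close> and the embedding \<open>e\<close> is a completion of \<open>'k\<close>
  with respect to \<open>v\<close>; such a completion is unique up to a unique isometric isomorphism
  over \<open>'k\<close>.\<close>

definition is_completion ::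
    "('k::field \<Rightarrow> real) \<Rightarrow> ('k \<Rightarrow> 'c::field) \<Rightarrow> ('c \<Rightarrow> real) \<Rightarrow> bool" where
  "is_completion v e w \<longleftrightarrow>
     e 1 = 1 \<and> (\<forall>x y. e (x + y) = e x + e y) \<and> (\<forall>x y. e (x * y) = e x * e y) \<and>
     absolute_value w \<and> (\<forall>x. w (e x) = v x) \<and>
     Metric_space.mcomplete UNIV (\<lambda>x y. w (x - y)) \<and>
     Metric_space.mtopology UNIV (\<lambda>x y. w (x - y)) closure_of (range e) = UNIV"

definition vec_norm :: "('k::field \<Rightarrow> real) \<Rightarrow> 'k ^ 'n::finite \<Rightarrow> real" where
  "vec_norm v x =
     (if non_archimedean v then Max (range (\<lambda>i. v (x $ i)))
      else L2_set (\<lambda>i. v (x $ i)) UNIV)"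

text \<open>Operator norm of a \<open>k\<close>-multilinear operator. As in \<open>onorm\<close>, tuples with a zero entry
  contribute \<open>0\<close> because of division by zero.\<close>

definition multilinear_norm ::
    "('c::field \<Rightarrow> real) \<Rightarrow> nat \<Rightarrow> (('c ^ 'n::finite) list \<Rightarrow> 'c ^ 'n) \<Rightarrow> real" where
  "multilinear_norm w k A =
     (SUP hs\<in>{hs. length hs = k}. vec_norm w (A hs) / (\<Prod>h\<leftarrow>hs. vec_norm w h))"

text \<open>The factor \<open>1 / k!\<close> is taken in the field, so that it also contributes to the norm when
  \<open>w\<close> is non-archimedean.\<close>

definition smale_gamma ::
    "('c::field \<Rightarrow> real) \<Rightarrow> ('n::finite, 'c) mpoly ^ 'n \<Rightarrow> 'c ^ 'n \<Rightarrow> real" where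
  "smale_gamma w F x =
     (SUP k\<in>{2..}. root (k - 1) (multilinear_norm w k
        (\<lambda>hs. inverse (of_nat (fact k)) *s (matrix_inv (jacobian F x) *v higher_deriv F x hs))))"

definition extend_vec :: "('k \<Rightarrow> 'c) \<Rightarrow> 'k ^ 'n \<Rightarrow> 'c ^ 'n" where
  "extend_vec e x = (\<chi> i. e (x $ i))"

definition extend_system ::
    "('k::field \<Rightarrow> 'c::field) \<Rightarrow> ('n::finite, 'k) mpoly ^ 'n \<Rightarrow> ('n, 'c) mpoly ^ 'n" where
  "extend_system e F = (\<chi> i. Poly_Mapping.map e (F $ i))"

definition newton :: "('n::finite, 'k::field) mpoly ^ 'n \<Rightarrow> 'k ^ 'n \<Rightarrow> 'k ^ 'n" where
  "newton F x = x - matrix_inv (jacobian F x) *v system_eval F x"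

definition smooth_zero :: "('n::finite, 'k::field) mpoly ^ 'n \<Rightarrow> 'k ^ 'n \<Rightarrow> bool" where
  "smooth_zero F x \<longleftrightarrow> system_eval F x = 0 \<and> invertible (jacobian F x)"

text \<open>Since \<open>matrix_inv\<close> is total, well-definedness of the Newton sequence is stated as
  invertibility of the Jacobian matrix at each of its terms.\<close>

definition approximate_zero ::
    "('k::field \<Rightarrow> real) \<Rightarrow> ('n::finite, 'k) mpoly ^ 'n \<Rightarrow> 'k ^ 'n \<Rightarrow> 'k ^ 'n \<Rightarrow> bool" where
  "approximate_zero v F \<zeta> z \<longleftrightarrow>
     smooth_zero F \<zeta> \<and>
     invertible (jacobian F z) \<and>
     (\<forall>k\<ge>1. invertible (jacobian F ((newton F ^^ k) z))) \<and>
     (\<forall>k\<ge>1. vec_norm v ((newton F ^^ k) z - \<zeta>) \<le> 1 / 2 ^ (2 ^ (k - 1)) * vec_norm v (z - \<zeta>))"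

end

theory Submission
  imports Defs "HOL-Computational_Algebra.Polynomial"
begin

text \<open>Put \<open>u = \<parallel>z - \<zeta>\<parallel> \<gamma>\<close>. By Taylor expansion at \<open>\<zeta>\<close>, \<open>DF(\<zeta>)\<^sup>-\<^sup>1 DF(z)\<close> differs from the identity by a sum of
  terms of norm at most \<open>k u\<^sup>k\<^sup>-\<^sup>1\<close> \<open>(k \<ge> 2)\<close>, so it enlarges norms by a factor at least \<open>2 - 1 / (1 - u)\<^sup>2\<close>,
  while \<open>DF(\<zeta>)\<^sup>-\<^sup>1 (DF(z) (z - \<zeta>) - F(z))\<close> has norm at most \<open>u / (1 - u)\<^sup>2 \<parallel>z - \<zeta>\<parallel>\<close>. Hence one Newton step
  multiplies the error by at most \<open>u / (1 - 4 u + 2 u\<^sup>2)\<close>, which is \<open>1/2\<close> at \<open>u = (3 - \<surd>7) / 2\<close>. The bounds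
  use only \<open>\<bar>k\<bar>\<^sub>\<nu> \<le> k\<close>, so both kinds of places are treated alike. Invertibility of \<open>DF(z)\<close> follows
  from its injectivity. All objects commute with the embedding into the completion, so the argument
  can be run there.\<close>

subsection \<open>Taylor expansion\<close>

lemma smult_sum_right: "smult c (\<Sum>a\<in>A. f a) = (\<Sum>a\<in>A. smult c (f a))"
  by (induction A rule: infinite_finite_induct) (auto simp: smult_add_right)

text \<open>A formal polynomial in the line parameter \<open>t\<close>, not a function of it: its
  coefficients carry the Taylor terms, and \<open>pderiv\<close> gives a calculus over any
  field.\<close>

definition line_poly :: "('n::finite, 'k::field) mpoly \<Rightarrow> 'k ^ 'n \<Rightarrow> 'k ^ 'n \<Rightarrow> 'k poly" where
  "line_poly p x h = (\<Sum>m\<in>Poly_Mapping.keys p. smult (Poly_Mapping.lookup p m)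
     (\<Prod>i\<in>UNIV. [:x $ i, h $ i:] ^ Poly_Mapping.lookup m i))"

lemma poly_line_poly: "poly (line_poly p x h) t = mpoly_eval p (x + t *s h)"
  by (simp add: line_poly_def mpoly_eval_def poly_sum poly_prod)

text \<open>Cancellation can shrink the keys of a sum, so additivity is proved over a common larger
  index set.\<close>

lemma line_poly_superset:
  assumes "finite S" "Poly_Mapping.keys p \<subseteq> S"
  shows "line_poly p x h = (\<Sum>m\<in>S. smult (Poly_Mapping.lookup p m)
     (\<Prod>i\<in>UNIV. [:x $ i, h $ i:] ^ Poly_Mapping.lookup m i))"
  unfolding line_poly_def
  by (rule sum.mono_neutral_left) (use assms in \<open>auto simp: in_keys_iff\<close>)

lemma line_poly_0 [simp]: "line_poly 0 x h = 0"
  by (simp add: line_poly_def)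

lemma line_poly_add: "line_poly (p + q) x h = line_poly p x h + line_poly q x h"
proof -
  let ?S = "Poly_Mapping.keys p \<union> Poly_Mapping.keys q"
  have "Poly_Mapping.keys (p + q) \<subseteq> ?S" by (rule keys_add)
  then show ?thesis
    by (simp add: line_poly_superset[of ?S] lookup_add smult_add_left sum.distrib)
qed

lemma line_poly_sum: "line_poly (\<Sum>a\<in>A. f a) x h = (\<Sum>a\<in>A. line_poly (f a) x h)"
  by (induction A rule: infinite_finite_induct) (auto simp: line_poly_add)

lemma line_poly_single: "line_poly (Poly_Mapping.single m c) x h =
    smult c (\<Prod>i\<in>UNIV. [:x $ i, h $ i:] ^ Poly_Mapping.lookup m i)"
  by (subst line_poly_superset[of "{m}"]) auto

text \<open>The chain rule along the line, monomial by monomial.\<close>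

lemma pderiv_line_poly:
  "pderiv (line_poly p x h) = (\<Sum>j\<in>UNIV. smult (h $ j) (line_poly (mpoly_pderiv j p) x h))"
proof -
  let ?l = "\<lambda>i. [:x $ i, h $ i:]"
  let ?c = "Poly_Mapping.lookup p"
  \<comment> \<open>Both sides truncate at exponent 0 in the same way; there the coefficient
    \<open>of_nat (Poly_Mapping.lookup m j)\<close> is 0.\<close>
  have mono: "(\<Prod>i\<in>UNIV. ?l i ^ Poly_Mapping.lookup (m - Poly_Mapping.single j 1) i) =
      ?l j ^ (Poly_Mapping.lookup m j - 1) * (\<Prod>i\<in>UNIV - {j}. ?l i ^ Poly_Mapping.lookup m i)" for m j
    by (subst prod.remove[of _ j]) (auto simp: lookup_minus lookup_single intro!: prod.cong)
  have "pderiv (line_poly p x h) = (\<Sum>m\<in>Poly_Mapping.keys p. \<Sum>j\<in>UNIV.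
      smult (h $ j) (smult (of_nat (Poly_Mapping.lookup m j) * ?c m)
        (\<Prod>i\<in>UNIV. ?l i ^ Poly_Mapping.lookup (m - Poly_Mapping.single j 1) i)))"
    unfolding line_poly_def mono
    by (simp add: higher_pderiv_sum[of 1, simplified] pderiv_smult pderiv_prod pderiv_power pderiv_pCons
        smult_sum_right mult_ac)
  also have "\<dots> = (\<Sum>j\<in>UNIV. smult (h $ j) (line_poly (mpoly_pderiv j p) x h))"
    by (subst sum.swap) (simp add: mpoly_pderiv_def line_poly_sum line_poly_single smult_sum_right)
  finally show ?thesis .
qed

section \<open>Higher derivatives as sums over index lists, and Taylor's formula\<close>

lemma sum_lists_Cons:
  fixes f :: "'a::finite list \<Rightarrow> 'b::comm_monoid_add"
  shows "(\<Sum>xs | length xs = Suc k. f xs) = (\<Sum>x\<in>UNIV. \<Sum>xs | length xs = k. f (x # xs))"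
  unfolding sum.cartesian_product
  by (rule sum.reindex_bij_witness[where i="\<lambda>(x, xs). x # xs" and j="\<lambda>xs. (hd xs, tl xs)"])
     (auto simp: length_Suc_conv)

text \<open>For derivatives whose last slot holds a different vector than the other slots.\<close>

lemma sum_lists_snoc:
  fixes f :: "'a::finite list \<Rightarrow> 'b::comm_monoid_add"
  shows "(\<Sum>xs | length xs = Suc k. f xs) = (\<Sum>x\<in>UNIV. \<Sum>xs | length xs = k. f (xs @ [x]))"
  unfolding sum.cartesian_product
  by (rule sum.reindex_bij_witness[where i="\<lambda>(x, xs). xs @ [x]" and j="\<lambda>xs. (last xs, butlast xs)"])
     (auto simp: length_Suc_conv_rev)

lemma higher_pderiv_line_poly:
  "(pderiv ^^ k) (line_poly p x h) = (\<Sum>js | length js = k.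
     smult (\<Prod>l<k. h $ (js ! l)) (line_poly (foldr mpoly_pderiv js p) x h))"
proof (induction k)
  case (Suc k)
  have "(pderiv ^^ Suc k) (line_poly p x h) = (\<Sum>js | length js = k. \<Sum>j\<in>UNIV.
      smult (\<Prod>l<Suc k. h $ ((j # js) ! l)) (line_poly (foldr mpoly_pderiv (j # js) p) x h))"
    by (simp add: Suc.IH higher_pderiv_sum[of 1, simplified] pderiv_smult pderiv_line_poly smult_sum_right
        prod.lessThan_Suc_shift mult_ac del: prod.lessThan_Suc)
  then show ?case
    by (subst (asm) sum.swap) (simp add: sum_lists_Cons)
qed simp

text \<open>The \<open>k\<close>-th derivative at 0 is \<open>k!\<close> times the coefficient.
  Characteristic 0 is the assumption \<open>char\<close> because the completion has only the class
  \<open>field\<close>.\<close>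

lemma coeff_line_poly:
  fixes p :: "('n::finite, 'k::field) mpoly"
  assumes char: "\<And>n. n > 0 \<Longrightarrow> of_nat n \<noteq> (0::'k)"
  shows "coeff (line_poly p x h) k = inverse (of_nat (fact k)) *
    (\<Sum>js | length js = k. mpoly_eval (foldr mpoly_pderiv js p) x * (\<Prod>l<k. h $ (js ! l)))"
proof -
  have "of_nat (fact k) * coeff (line_poly p x h) k = coeff ((pderiv ^^ k) (line_poly p x h)) 0"
    using pochhammer_of_nat[of 1 k, where 'a='k] by (simp add: coeff_higher_pderiv pochhammer_fact)
  also have "\<dots> = poly ((pderiv ^^ k) (line_poly p x h)) 0"
    by (simp add: poly_0_coeff_0)
  also have "\<dots> = (\<Sum>js | length js = k. mpoly_eval (foldr mpoly_pderiv js p) x * (\<Prod>l<k. h $ (js ! l)))"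
    by (simp add: higher_pderiv_line_poly poly_sum poly_line_poly mult.commute)
  finally show ?thesis
    using char[of "fact k"] by (simp add: field_simps)
qed

text \<open>Evaluate the restriction to the line at \<open>t = 1\<close>; \<open>vanish\<close>
  bounds its degree by \<open>N\<close>.\<close>

lemma mpoly_taylor:
  fixes p :: "('n::finite, 'k::field) mpoly"
  assumes char: "\<And>n. n > 0 \<Longrightarrow> of_nat n \<noteq> (0::'k)"
    and vanish: "\<And>js. length js > N \<Longrightarrow> mpoly_eval (foldr mpoly_pderiv js p) x = 0"
  shows "mpoly_eval p (x + h) = (\<Sum>k\<le>N. inverse (of_nat (fact k)) *
    (\<Sum>js | length js = k. mpoly_eval (foldr mpoly_pderiv js p) x * (\<Prod>l<k. h $ (js ! l))))"
proof -
  have "degree (line_poly p x h) \<le> N"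
    by (rule degree_le) (auto simp: coeff_line_poly[OF char] vanish)
  then have "poly (line_poly p x h) 1 = (\<Sum>k\<le>N. coeff (line_poly p x h) k)"
    unfolding poly_altdef
    by (intro sum.mono_neutral_cong_left) (auto simp: coeff_eq_0)
  then show ?thesis
    by (simp add: poly_line_poly coeff_line_poly[OF char])
qed

section \<open>Degree bounds: the expansion terminates\<close>

lemma foldr_mpoly_pderiv_deg:
  assumes "\<forall>m\<in>Poly_Mapping.keys p. (\<Sum>i\<in>UNIV. Poly_Mapping.lookup m i) < d"
  shows "\<forall>m\<in>Poly_Mapping.keys (foldr mpoly_pderiv js p). (\<Sum>i\<in>UNIV. Poly_Mapping.lookup m i) < d - length js"
proof (induction js)
  case (Cons j js)
  let ?q = "foldr mpoly_pderiv js p"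
  show ?case
  proof
    fix m assume "m \<in> Poly_Mapping.keys (foldr mpoly_pderiv (j # js) p)"
    then have "m \<in> Poly_Mapping.keys (mpoly_pderiv j ?q)" by simp
    then obtain m' where m': "m' \<in> Poly_Mapping.keys ?q"
      and m: "m \<in> Poly_Mapping.keys (Poly_Mapping.single (m' - Poly_Mapping.single j 1)
        (of_nat (Poly_Mapping.lookup m' j) * Poly_Mapping.lookup ?q m'))"
      unfolding mpoly_pderiv_def by (auto dest!: subsetD[OF keys_sum])
    \<comment> \<open>A nonzero coefficient forces the exponent of \<open>j\<close> to be positive,
      so the subtraction really lowers the degree.\<close>
    from m have m_eq: "m = m' - Poly_Mapping.single j 1" and pos: "Poly_Mapping.lookup m' j > 0"
      by (cases "Poly_Mapping.lookup m' j = 0"; simp split: if_splits)+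
    have "(\<Sum>i\<in>UNIV. Poly_Mapping.lookup m i) < (\<Sum>i\<in>UNIV. Poly_Mapping.lookup m' i)" (is "?s < ?s'")
      by (rule sum_strict_mono_ex1)
         (use pos in \<open>auto simp: m_eq lookup_minus lookup_single when_def intro!: exI[of _ j]\<close>)
    moreover have "?s' < d - length js" using Cons.IH m' by (rule bspec)
    ultimately show "(\<Sum>i\<in>UNIV. Poly_Mapping.lookup m i) < d - length (j # js)" by simp
  qed
qed (use assms in simp)

text \<open>One \<open>N\<close> serves all components and points. It makes the Taylor sums finite
  and, later, the set under the supremum in \<open>smale_gamma\<close> bounded.\<close>

lemma higher_deriv_vanishes:
  fixes F :: "('n::finite, 'k::field) mpoly ^ 'n"
  obtains N where "\<And>i js x. length js > N \<Longrightarrow> mpoly_eval (foldr mpoly_pderiv js (F $ i)) x = 0"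
proof -
  have "finite (\<Union>i. (\<lambda>m. \<Sum>l\<in>UNIV. Poly_Mapping.lookup m l) ` Poly_Mapping.keys (F $ i))" by simp
  then obtain d where d: "\<forall>i. \<forall>m\<in>Poly_Mapping.keys (F $ i). (\<Sum>l\<in>UNIV. Poly_Mapping.lookup m l) < d"
    unfolding finite_nat_set_iff_bounded by blast
  have "mpoly_eval (foldr mpoly_pderiv js (F $ i)) x = 0" if "length js > d" for i js x
  proof -
    have "Poly_Mapping.keys (foldr mpoly_pderiv js (F $ i)) = {}"
      using foldr_mpoly_pderiv_deg[of "F $ i" d js] d that by auto
    then show ?thesis by (simp add: mpoly_eval_def)
  qed
  with that show thesis by blast
qed

lemma system_taylor:
  fixes F :: "('n::finite, 'k::field) mpoly ^ 'n"
  assumes char: "\<And>n. n > 0 \<Longrightarrow> of_nat n \<noteq> (0::'k)"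
    and vanish: "\<And>i js. length js > N \<Longrightarrow> mpoly_eval (foldr mpoly_pderiv js (F $ i)) x = 0"
  shows "system_eval F (x + h) =
    (\<Sum>k\<le>N. inverse (of_nat (fact k)) *s higher_deriv F x (replicate k h))"
  using vanish
  by (simp add: vec_eq_iff system_eval_def higher_deriv_def mpoly_taylor[OF char, of N])

text \<open>Taylor's formula for each first partial derivative. The operator has order
  \<open>k + 1\<close> but the coefficient is \<open>1 / k!\<close>; this mismatch produces the
  factor \<open>k + 1\<close> in \<open>newton_contraction\<close>.\<close>

lemma jacobian_taylor:
  fixes F :: "('n::finite, 'k::field) mpoly ^ 'n"
  assumes char: "\<And>n. n > 0 \<Longrightarrow> of_nat n \<noteq> (0::'k)"
    and vanish: "\<And>i js. length js > N \<Longrightarrow> mpoly_eval (foldr mpoly_pderiv js (F $ i)) x = 0"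
  shows "jacobian F (x + h) *v y =
    (\<Sum>k\<le>N. inverse (of_nat (fact k)) *s higher_deriv F x (replicate k h @ [y]))"
proof -
  \<comment> \<open>\<open>foldr\<close> applies the last index first, so appending \<open>j\<close>
    means differentiating by \<open>j\<close> before the rest.\<close>
  have v: "mpoly_eval (foldr mpoly_pderiv js (mpoly_pderiv j (F $ i))) x = 0" if "length js > N" for i j js
    using vanish[of "js @ [j]" i] that by simp
  have D: "higher_deriv F x (replicate k h @ [y]) $ i = (\<Sum>j\<in>UNIV. \<Sum>js | length js = k.
     mpoly_eval (foldr mpoly_pderiv js (mpoly_pderiv j (F $ i))) x * (\<Prod>l<k. h $ (js ! l)) * y $ j)" for k i
    unfolding higher_deriv_def
    by (auto simp: sum_lists_snoc nth_append mult_ac intro!: sum.cong prod.cong)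
  have "(jacobian F (x + h) *v y) $ i =
    (\<Sum>k\<le>N. inverse (of_nat (fact k)) *s higher_deriv F x (replicate k h @ [y])) $ i" for i
  proof -
    have "(jacobian F (x + h) *v y) $ i = (\<Sum>j\<in>UNIV. \<Sum>k\<le>N. inverse (of_nat (fact k)) * (\<Sum>js | length js = k.
      mpoly_eval (foldr mpoly_pderiv js (mpoly_pderiv j (F $ i))) x * (\<Prod>l<k. h $ (js ! l)) * y $ j))"
      by (simp add: matrix_vector_mult_def jacobian_def mpoly_taylor[OF char v] sum_distrib_right mult.assoc)
    then show ?thesis
      by (subst (asm) sum.swap) (simp add: D sum_distrib_left)
  qed
  then show ?thesis by (simp add: vec_eq_iff)
qed

lemma higher_deriv_Nil: "higher_deriv F x [] = system_eval F x"
  by (simp add: higher_deriv_def system_eval_def)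

lemma higher_deriv_singleton: "higher_deriv F x [y] = jacobian F x *v y"
  by (simp add: vec_eq_iff higher_deriv_def jacobian_def matrix_vector_mult_def sum_lists_Cons[where k=0, simplified])

subsection \<open>Absolute values and norms\<close>

context
  fixes v :: "'k::field \<Rightarrow> real"
  assumes av: "absolute_value v"
begin

lemma abs_val_nonneg: "0 \<le> v x"
  and abs_val_eq_0_iff: "v x = 0 \<longleftrightarrow> x = 0"
  and abs_val_mult: "v (x * y) = v x * v y"
  and abs_val_triangle: "v (x + y) \<le> v x + v y"
  using av by (auto simp: absolute_value_def)

lemma abs_val_0: "v 0 = 0"
  by (simp add: abs_val_eq_0_iff)

lemma abs_val_1: "v 1 = 1"
  using abs_val_mult[of 1 1] abs_val_eq_0_iff[of 1] by simp

lemma abs_val_minus: "v (- x) = v x"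
proof -
  have "v (- 1) * v (- 1) = 1"
    using abs_val_mult[of "- 1" "- 1"] abs_val_1 by simp
  then have "v (- 1) = 1"
    using abs_val_nonneg[of "- 1"] by (simp add: square_eq_1_iff)
  then show ?thesis
    using abs_val_mult[of "- 1" x] by simp
qed

lemma abs_val_of_nat_le: "v (of_nat n) \<le> real n"
proof (induction n)
  case (Suc n)
  then show ?case
    using abs_val_triangle[of 1 "of_nat n"] abs_val_1 by simp
qed (simp add: abs_val_0)

lemma abs_val_sum_le: "v (\<Sum>a\<in>A. f a) \<le> (\<Sum>a\<in>A. v (f a))"
proof (induction A rule: infinite_finite_induct)
  case (insert a A)
  then show ?case
    using abs_val_triangle[of "f a" "sum f A"] by simp
qed (simp_all add: abs_val_0)

lemma abs_val_prod: "v (\<Prod>a\<in>A. f a) = (\<Prod>a\<in>A. v (f a))"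
  by (induction A rule: infinite_finite_induct) (simp_all add: abs_val_mult abs_val_1)

lemma abs_val_le_vec_norm: "v (x $ i) \<le> vec_norm v x"
  using member_le_L2_set[of UNIV i "\<lambda>i. v (x $ i)"] by (simp add: vec_norm_def)

lemma vec_norm_nonneg: "0 \<le> vec_norm v x"
  using abs_val_le_vec_norm abs_val_nonneg order_trans by blast

text \<open>With \<open>abs_val_le_vec_norm\<close> this brackets the norm for both kinds of places,
  so crude estimates need no case distinction.\<close>

lemma vec_norm_le_sum: "vec_norm v x \<le> (\<Sum>i\<in>UNIV. v (x $ i))"
  by (auto simp: vec_norm_def abs_val_nonneg intro!: L2_set_le_sum member_le_sum)

lemma vec_norm_eq_0_iff: "vec_norm v x = 0 \<longleftrightarrow> x = 0"
proof
  assume "vec_norm v x = 0"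
  then have "v (x $ i) = 0" for i
    using abs_val_le_vec_norm[of x i] abs_val_nonneg[of "x $ i"] by simp
  then show "x = 0"
    by (simp add: vec_eq_iff abs_val_eq_0_iff)
next
  assume "x = 0"
  then show "vec_norm v x = 0"
    using vec_norm_le_sum[of x] vec_norm_nonneg[of x] by (simp add: abs_val_0)
qed

lemma vec_norm_0: "vec_norm v 0 = 0"
  by (simp add: vec_norm_eq_0_iff)

lemma vec_norm_triangle:
  fixes x y :: "'k ^ 'n"
  shows "vec_norm v (x + y) \<le> vec_norm v x + vec_norm v y"
proof (cases "non_archimedean v")
  case True
  then have eq: "vec_norm v z = Max (range (\<lambda>i. v (z $ i)))" for z
    by (simp add: vec_norm_def)
  have "v (x $ i + y $ i) \<le> vec_norm v x + vec_norm v y" for i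
    using abs_val_triangle abs_val_le_vec_norm add_mono order_trans by meson
  then show ?thesis
    by (subst eq) simp
next
  case False
  have "L2_set (\<lambda>i. v (x $ i + y $ i)) UNIV \<le> L2_set (\<lambda>i. v (x $ i) + v (y $ i)) UNIV"
    by (intro L2_set_mono abs_val_triangle abs_val_nonneg)
  also have "\<dots> \<le> L2_set (\<lambda>i. v (x $ i)) UNIV + L2_set (\<lambda>i. v (y $ i)) UNIV"
    by (rule L2_set_triangle_ineq)
  finally show ?thesis
    using False by (simp add: vec_norm_def)
qed

lemma vec_norm_scale: "vec_norm v (c *s x) = v c * vec_norm v x"
proof -
  have "Max (range (\<lambda>i. v c * v (x $ i))) = v c * Max (range (\<lambda>i. v (x $ i)))"
    using mono_Max_commute[of "(*) (v c)" "range (\<lambda>i. v (x $ i))"]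
    by (simp add: mono_def mult_left_mono abs_val_nonneg image_image)
  then show ?thesis
    by (simp add: vec_norm_def abs_val_mult L2_set_right_distrib abs_val_nonneg)
qed

lemma vec_norm_minus: "vec_norm v (- x) = vec_norm v x"
  by (simp add: vec_norm_def abs_val_minus)

lemma vec_norm_minus_commute: "vec_norm v (x - y) = vec_norm v (y - x)"
  using vec_norm_minus[of "x - y"] by simp

lemma vec_norm_sum_le: "vec_norm v (\<Sum>a\<in>A. f a) \<le> (\<Sum>a\<in>A. vec_norm v (f a))"
proof (induction A rule: infinite_finite_induct)
  case (insert a A)
  then show ?case
    using vec_norm_triangle[of "f a" "sum f A"] by simp
qed (simp_all add: vec_norm_0)

text \<open>The constant is crude; only its existence matters, to show that the suprema in the
  operator norms are over bounded sets.\<close>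

lemma vec_norm_matrix_vector_le:
  fixes M :: "'k ^ 'n ^ 'm"
  shows "vec_norm v (M *v x) \<le> (\<Sum>i\<in>UNIV. \<Sum>j\<in>UNIV. v (M $ i $ j)) * vec_norm v x"
proof -
  have "v ((M *v x) $ i) \<le> (\<Sum>j\<in>UNIV. v (M $ i $ j)) * vec_norm v x" for i
  proof -
    have "v ((M *v x) $ i) \<le> (\<Sum>j\<in>UNIV. v (M $ i $ j * x $ j))"
      by (simp add: matrix_vector_mult_def abs_val_sum_le)
    also have "\<dots> \<le> (\<Sum>j\<in>UNIV. v (M $ i $ j) * vec_norm v x)"
      by (intro sum_mono) (simp add: abs_val_mult mult_left_mono abs_val_nonneg abs_val_le_vec_norm)
    finally show ?thesis
      by (simp add: sum_distrib_right)
  qed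
  then have "(\<Sum>i\<in>UNIV. v ((M *v x) $ i)) \<le> (\<Sum>i\<in>UNIV. (\<Sum>j\<in>UNIV. v (M $ i $ j)) * vec_norm v x)"
    by (intro sum_mono)
  then show ?thesis
    using vec_norm_le_sum[of "M *v x"] by (simp add: sum_distrib_right)
qed

section \<open>Operator norms of multilinear maps, and gamma\<close>

lemma prod_vec_norm_nonneg: "0 \<le> (\<Prod>h\<leftarrow>hs. vec_norm v h)"
  by (induction hs) (simp_all add: vec_norm_nonneg)

lemma vec_norm_higher_deriv_le:
  fixes F :: "('n::finite, 'k) mpoly ^ 'n"
  shows
  "\<exists>C. \<forall>hs. length hs = k \<longrightarrow> vec_norm v (higher_deriv F x hs) \<le> C * (\<Prod>h\<leftarrow>hs. vec_norm v h)"
proof (intro exI allI impI)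
  fix hs :: "('k ^ 'n) list"
  assume k: "length hs = k"
  let ?c = "\<lambda>i js. v (mpoly_eval (foldr mpoly_pderiv js (F $ i)) x)"
  have eq: "(\<Prod>h\<leftarrow>hs. vec_norm v h) = (\<Prod>l<length hs. vec_norm v (hs ! l))"
    by (simp add: prod.list_conv_set_nth lessThan_atLeast0)
  have "v (higher_deriv F x hs $ i) \<le> (\<Sum>js | length js = k. ?c i js) * (\<Prod>h\<leftarrow>hs. vec_norm v h)" for i
  proof -
    have "v (higher_deriv F x hs $ i) \<le> (\<Sum>js | length js = k. ?c i js * (\<Prod>l<length hs. v ((hs ! l) $ (js ! l))))"
      unfolding higher_deriv_def vec_lambda_beta k
      by (rule order_trans[OF abs_val_sum_le]) (simp add: abs_val_mult abs_val_prod k)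
    also have "\<dots> \<le> (\<Sum>js | length js = k. ?c i js * (\<Prod>h\<leftarrow>hs. vec_norm v h))"
      unfolding eq by (intro sum_mono mult_left_mono prod_mono) (simp_all add: abs_val_nonneg abs_val_le_vec_norm)
    finally show ?thesis
      by (simp add: sum_distrib_right)
  qed
  then have "(\<Sum>i\<in>UNIV. v (higher_deriv F x hs $ i)) \<le>
      (\<Sum>i\<in>UNIV. (\<Sum>js | length js = k. ?c i js) * (\<Prod>h\<leftarrow>hs. vec_norm v h))"
    by (intro sum_mono)
  then show "vec_norm v (higher_deriv F x hs) \<le>
      (\<Sum>i\<in>UNIV. \<Sum>js | length js = k. ?c i js) * (\<Prod>h\<leftarrow>hs. vec_norm v h)"
    using vec_norm_le_sum[of "higher_deriv F x hs"] by (simp add: sum_distrib_right)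
qed

text \<open>A real supremum is informative only for a nonempty set bounded above;
  \<open>bound\<close> makes the set of quotients bounded.\<close>

lemma multilinear_norm_upper:
  fixes A :: "('k ^ 'n) list \<Rightarrow> 'k ^ 'n"
  assumes bound: "\<exists>C. \<forall>hs. length hs = k \<longrightarrow> vec_norm v (A hs) \<le> C * (\<Prod>h\<leftarrow>hs. vec_norm v h)"
  shows multilinear_norm_nonneg: "0 \<le> multilinear_norm v k A"
    and vec_norm_le_multilinear_norm: "length hs = k \<Longrightarrow>
      vec_norm v (A hs) \<le> multilinear_norm v k A * (\<Prod>h\<leftarrow>hs. vec_norm v h)"
proof -
  obtain C where C: "\<And>hs. length hs = k \<Longrightarrow> vec_norm v (A hs) \<le> C * (\<Prod>h\<leftarrow>hs. vec_norm v h)"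
    using bound by blast
  \<comment> \<open>The maximum with 0 covers quotients by zero, since \<open>C\<close> may be
    negative.\<close>
  have "vec_norm v (A hs) / (\<Prod>h\<leftarrow>hs. vec_norm v h) \<le> max C 0" if "length hs = k" for hs
  proof (cases "(\<Prod>h\<leftarrow>hs. vec_norm v h) = 0")
    case False
    then have "(\<Prod>h\<leftarrow>hs. vec_norm v h) > 0"
      using prod_vec_norm_nonneg[of hs] by simp
    with C[OF that] show ?thesis
      by (simp add: divide_le_eq le_max_iff_disj)
  qed simp
  then have bdd: "bdd_above ((\<lambda>hs. vec_norm v (A hs) / (\<Prod>h\<leftarrow>hs. vec_norm v h)) ` {hs. length hs = k})"
    by (intro bdd_aboveI2[where M="max C 0"]) simp
  have upper: "vec_norm v (A hs) / (\<Prod>h\<leftarrow>hs. vec_norm v h) \<le> multilinear_norm v k A"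
    if "length hs = k" for hs
    unfolding multilinear_norm_def using bdd that by (intro cSUP_upper) auto
  have "0 \<le> vec_norm v (A (replicate k 0)) / (\<Prod>h\<leftarrow>replicate k (0::'k^'n). vec_norm v h)"
    by (intro divide_nonneg_nonneg vec_norm_nonneg prod_vec_norm_nonneg)
  also have "\<dots> \<le> multilinear_norm v k A"
    by (rule upper) simp
  finally show "0 \<le> multilinear_norm v k A" .
  show "vec_norm v (A hs) \<le> multilinear_norm v k A * (\<Prod>h\<leftarrow>hs. vec_norm v h)" if "length hs = k"
  proof (cases "(\<Prod>h\<leftarrow>hs. vec_norm v h) = 0")
    \<comment> \<open>The quotient carries no information here; the bound by \<open>C\<close> shows
      that the left side is at most 0.\<close>
    case True
    with C[OF that] show ?thesis by simp
  next
    case False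
    then have "(\<Prod>h\<leftarrow>hs. vec_norm v h) > 0"
      using prod_vec_norm_nonneg[of hs] by simp
    with upper[OF that] show ?thesis
      by (simp add: divide_le_eq)
  qed
qed

text \<open>Derivatives of order above \<open>N\<close> vanish, so only finitely many of the roots
  are nonzero and the supremum bounds each of them.\<close>

lemma smale_gamma_upper:
  fixes F :: "('n::finite, 'k) mpoly ^ 'n"
  shows smale_gamma_nonneg: "0 \<le> smale_gamma v F x"
    and vec_norm_le_smale_gamma: "length hs \<ge> 2 \<Longrightarrow>
      vec_norm v (inverse (of_nat (fact (length hs))) *s (matrix_inv (jacobian F x) *v higher_deriv F x hs))
        \<le> smale_gamma v F x ^ (length hs - 1) * (\<Prod>h\<leftarrow>hs. vec_norm v h)"
proof -
  define T where "T = (\<lambda>k hs. inverse (of_nat (fact k)) *s (matrix_inv (jacobian F x) *v higher_deriv F x hs))"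
  let ?r = "\<lambda>k. root (k - 1) (multilinear_norm v k (T k))"
  have gamma: "smale_gamma v F x = (SUP k\<in>{2..}. ?r k)"
    by (simp add: smale_gamma_def T_def)
  have bound: "\<exists>C. \<forall>hs. length hs = k \<longrightarrow> vec_norm v (T k hs) \<le> C * (\<Prod>h\<leftarrow>hs. vec_norm v h)" for k
  proof -
    define C1 where "C1 = (\<Sum>i\<in>UNIV. \<Sum>j\<in>UNIV. v (matrix_inv (jacobian F x) $ i $ j))"
    obtain C2 where C2: "\<And>hs. length hs = k \<Longrightarrow>
        vec_norm v (higher_deriv F x hs) \<le> C2 * (\<Prod>h\<leftarrow>hs. vec_norm v h)"
      using vec_norm_higher_deriv_le by blast
    have "C1 \<ge> 0"
      by (simp add: C1_def sum_nonneg abs_val_nonneg)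
    have "vec_norm v (T k hs) \<le> (v (inverse (of_nat (fact k))) * C1 * C2) * (\<Prod>h\<leftarrow>hs. vec_norm v h)"
      if "length hs = k" for hs
    proof -
      have "vec_norm v (T k hs) \<le> v (inverse (of_nat (fact k))) * (C1 * vec_norm v (higher_deriv F x hs))"
        unfolding T_def vec_norm_scale C1_def
        by (intro mult_left_mono vec_norm_matrix_vector_le abs_val_nonneg)
      also have "\<dots> \<le> v (inverse (of_nat (fact k))) * (C1 * (C2 * (\<Prod>h\<leftarrow>hs. vec_norm v h)))"
        by (intro mult_left_mono C2 that \<open>C1 \<ge> 0\<close> abs_val_nonneg)
      finally show ?thesis
        by (simp add: mult.assoc)
    qed
    then show ?thesis by blast
  qed
  have nonneg: "0 \<le> ?r k" for k
    by (intro real_root_ge_zero multilinear_norm_nonneg bound)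
  obtain N where N: "\<And>i js. length js > N \<Longrightarrow> mpoly_eval (foldr mpoly_pderiv js (F $ i)) x = 0"
    using higher_deriv_vanishes by metis
  have "?r k = 0" if "k > N" "k \<ge> 2" for k
  proof -
    have T0: "T k hs = 0" if "length hs = k" for hs
    proof -
      have "higher_deriv F x hs = 0"
        using N that \<open>k > N\<close> by (simp add: higher_deriv_def vec_eq_iff)
      then show ?thesis by (simp add: T_def)
    qed
    \<comment> \<open>The supremum of the constant 0 is 0 because the index set is nonempty.\<close>
    have "{hs :: ('k ^ 'n) list. length hs = k} \<noteq> {}"
      using Ex_list_of_length by auto
    then have "multilinear_norm v k (T k) = 0"
      unfolding multilinear_norm_def by (simp add: T0 vec_norm_0 cong: SUP_cong_simp)
    then show ?thesis by simp
  qed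
  then have "?r k \<in> ?r ` {2..N} \<union> {0}" if "k \<ge> 2" for k
    using that by (cases "k \<le> N") auto
  then have "?r ` {2..} \<subseteq> ?r ` {2..N} \<union> {0}"
    by blast
  then have bdd: "bdd_above (?r ` {2..})"
    by (rule bdd_above_mono[rotated]) simp
  have upper: "?r k \<le> smale_gamma v F x" if "k \<ge> 2" for k
    unfolding gamma using bdd that by (intro cSUP_upper) auto
  show "0 \<le> smale_gamma v F x"
    using nonneg[of 2] upper[of 2] by simp
  assume k: "length hs \<ge> 2"
  let ?k = "length hs"
  have "multilinear_norm v ?k (T ?k) = ?r ?k ^ (?k - 1)"
    using k multilinear_norm_nonneg[OF bound] by (simp add: real_root_pow_pos2)
  also have "\<dots> \<le> smale_gamma v F x ^ (?k - 1)"
    by (intro power_mono upper nonneg k)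
  finally have "vec_norm v (T ?k hs) \<le> smale_gamma v F x ^ (?k - 1) * (\<Prod>h\<leftarrow>hs. vec_norm v h)"
    using vec_norm_le_multilinear_norm[OF bound refl, of hs] prod_vec_norm_nonneg[of hs]
    by (meson mult_right_mono order_trans)
  then show "vec_norm v (inverse (of_nat (fact ?k)) *s (matrix_inv (jacobian F x) *v higher_deriv F x hs))
        \<le> smale_gamma v F x ^ (?k - 1) * (\<Prod>h\<leftarrow>hs. vec_norm v h)"
    by (simp add: T_def)
qed

end

subsection \<open>The gamma theorem over a valued field\<close>

text \<open>Partial sums of the derivative of the geometric series, whose terms are
  nonnegative.\<close>

lemma sum_Suc_mult_power_le:
  fixes u :: real
  assumes "0 \<le> u" "u < 1"
  shows "(\<Sum>k<n. real (Suc k) * u ^ k) \<le> 1 / (1 - u)\<^sup>2"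
proof -
  have sums: "(\<lambda>k. real (Suc k) * u ^ k) sums (1 / (1 - u)\<^sup>2)"
    using geometric_deriv_sums[of u] assms by simp
  show ?thesis
    using sum_le_suminf[OF sums_summable[OF sums], of "{..<n}"] sums_unique[OF sums] assms by simp
qed

text \<open>In \<open>newton_contraction\<close> the first bound serves the Newton error, the second
  the deviation of \<open>B ** J\<close> from the identity.\<close>

lemma sum_mult_power_le:
  fixes u :: real
  assumes "0 \<le> u" "u < 1"
  shows "(\<Sum>k=1..n. real k * u ^ k) \<le> u / (1 - u)\<^sup>2"
    and "(\<Sum>k=1..n. real (Suc k) * u ^ k) \<le> 1 / (1 - u)\<^sup>2 - 1"
proof -
  have "(\<Sum>k=1..n. real k * u ^ k) = u * (\<Sum>k<n. real (Suc k) * u ^ k)"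
    unfolding sum_distrib_left
    by (rule sum.reindex_bij_witness[of _ Suc "\<lambda>k. k - 1"]) (auto simp: power_eq_if)
  also have "\<dots> \<le> u * (1 / (1 - u)\<^sup>2)"
    by (intro mult_left_mono sum_Suc_mult_power_le assms)
  finally show "(\<Sum>k=1..n. real k * u ^ k) \<le> u / (1 - u)\<^sup>2"
    by simp
  have "1 + (\<Sum>k=1..n. real (Suc k) * u ^ k) = (\<Sum>k<Suc n. real (Suc k) * u ^ k)"
    by (simp add: lessThan_Suc_atMost atMost_atLeast0 sum.atLeast_Suc_atMost)
  then show "(\<Sum>k=1..n. real (Suc k) * u ^ k) \<le> 1 / (1 - u)\<^sup>2 - 1"
    using sum_Suc_mult_power_le[OF assms, of "Suc n"] by linarith
qed

lemma matrix_vector_mult_sum_right: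
  fixes M :: "'k::field ^ 'n ^ 'm"
  shows "M *v (\<Sum>a\<in>A. f a) = (\<Sum>a\<in>A. M *v f a)"
  by (induction A rule: infinite_finite_induct) (auto simp: matrix_vector_right_distrib)

lemma matrix_inv_mult:
  fixes M :: "'k::field ^ 'n ^ 'n"
  assumes "invertible M"
  shows "M ** matrix_inv M = mat 1" "matrix_inv M ** M = mat 1"
  using someI_ex[OF assms[unfolded invertible_def]] unfolding matrix_inv_def by blast+

text \<open>Stated without division. Positivity of \<open>1 - 4 * u + 2 * u^2\<close> amounts to
  that of the expansion factor \<open>2 - 1 / (1 - u)^2\<close>, which makes the Jacobian
  injective.\<close>

lemma newton_contraction:
  fixes F :: "('n::finite, 'k::field) mpoly ^ 'n"
  assumes av: "absolute_value v"
    and char: "\<And>n. n > 0 \<Longrightarrow> of_nat n \<noteq> (0::'k)"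
    and zero: "smooth_zero F \<zeta>"
    and u_def: "u = vec_norm v (z - \<zeta>) * smale_gamma v F \<zeta>"
    and u: "u < 1" "0 < 1 - 4 * u + 2 * u\<^sup>2"
  shows "invertible (jacobian F z)"
    and "(1 - 4 * u + 2 * u\<^sup>2) * vec_norm v (newton F z - \<zeta>) \<le> u * vec_norm v (z - \<zeta>)"
proof -
  define h where "h = z - \<zeta>"
  define B where "B = matrix_inv (jacobian F \<zeta>)"
  define J where "J = jacobian F z"
  define T where "T hs = inverse (of_nat (fact (length hs))) *s (B *v higher_deriv F \<zeta> hs)" for hs
  let ?n = "vec_norm v"
  have z: "z = \<zeta> + h" by (simp add: h_def)
  have B: "B ** jacobian F \<zeta> = mat 1"
    using zero unfolding B_def smooth_zero_def by (simp add: matrix_inv_mult)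
  have u0: "0 \<le> u"
    unfolding u_def by (intro mult_nonneg_nonneg vec_norm_nonneg smale_gamma_nonneg av)
  obtain N where N: "\<And>i js. length js > N \<Longrightarrow> mpoly_eval (foldr mpoly_pderiv js (F $ i)) \<zeta> = 0"
    using higher_deriv_vanishes by metis
  \<comment> \<open>The tuple has \<open>k + 1\<close> entries, so gamma enters with power
    \<open>k\<close>, matched by the \<open>k\<close> copies of \<open>h\<close>.\<close>
  have T_le: "?n (T (replicate k h @ [y])) \<le> u ^ k * ?n y" if "k \<ge> 1" for k y
    using vec_norm_le_smale_gamma[OF av, of "replicate k h @ [y]" F \<zeta>] that
    by (simp add: T_def B_def u_def h_def power_mult_distrib mult_ac prod_list_replicate)
  have J: "B *v (J *v y) = y + (\<Sum>k=1..N. of_nat (Suc k) *s T (replicate k h @ [y]))" for y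
  proof -
    have "B *v (J *v y) = (\<Sum>k\<le>N. of_nat (Suc k) *s T (replicate k h @ [y]))"
    proof -
      \<comment> \<open>Turns the coefficient \<open>1 / k!\<close> of the Jacobian expansion into
        the normalization \<open>1 / (k + 1)!\<close> of \<open>T\<close>.\<close>
      have inv_fact: "inverse (of_nat (fact k)) = of_nat (Suc k) * inverse (of_nat (fact (Suc k)) :: 'k)" for k
        using char[of "Suc k"] char[of "fact k"]
        by (simp only: fact_Suc of_nat_id of_nat_mult) (simp add: field_simps del: of_nat_Suc)
      have "inverse (of_nat (fact k)) *s (B *v higher_deriv F \<zeta> (replicate k h @ [y])) =
          of_nat (Suc k) *s T (replicate k h @ [y])" for k
        by (subst inv_fact) (simp add: T_def vector_smult_assoc del: of_nat_Suc fact_Suc)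
      then show ?thesis
        unfolding J_def z by (subst jacobian_taylor[OF char N])
          (simp_all add: matrix_vector_mult_sum_right vector_scalar_commute del: of_nat_Suc)
    qed
    also have "\<dots> = T [y] + (\<Sum>k=1..N. of_nat (Suc k) *s T (replicate k h @ [y]))"
      by (simp add: atMost_atLeast0 sum.atLeast_Suc_atMost)
    also have "T [y] = y"
      by (simp add: T_def higher_deriv_singleton matrix_vector_mul_assoc B)
    finally show ?thesis .
  qed
  have E: "B *v system_eval F z = h + (\<Sum>k=1..N. T (replicate k h @ [h]))"
  proof -
    \<comment> \<open>One order more than \<open>N\<close>, so that after splitting off orders 0 and
      1 the tail has the same index range as in \<open>J\<close>.\<close>
    have "B *v system_eval F z = (\<Sum>k\<le>Suc N. T (replicate k h))"
      unfolding z by (subst system_taylor[OF char, of "Suc N"])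
        (auto simp: N matrix_vector_mult_sum_right vector_scalar_commute T_def simp del: sum.atMost_Suc)
    also have "\<dots> = T [] + (T [h] + (\<Sum>k=1..N. T (replicate (Suc k) h)))"
      unfolding sum.atMost_Suc_shift by (simp add: atMost_atLeast0 sum.atLeast_Suc_atMost)
    also have "T [] = 0"
      using zero by (simp add: T_def higher_deriv_Nil smooth_zero_def)
    also have "T [h] = h"
      by (simp add: T_def higher_deriv_singleton matrix_vector_mul_assoc B)
    finally show ?thesis
      by (simp add: replicate_append_same)
  qed
  \<comment> \<open>Reverse triangle inequality: \<open>y\<close> is \<open>B *v (J *v y)\<close>
    plus a deviation controlled by the second series bound.\<close>
  have lower: "(2 - 1 / (1 - u)\<^sup>2) * ?n y \<le> ?n (B *v (J *v y))" for y
  proof -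
    have "?n (\<Sum>k=1..N. of_nat (Suc k) *s T (replicate k h @ [y])) \<le>
        (\<Sum>k=1..N. real (Suc k) * (u ^ k * ?n y))"
      by (intro order_trans[OF vec_norm_sum_le[OF av]] sum_mono)
         (auto simp: vec_norm_scale[OF av] simp del: of_nat_Suc
           intro!: mult_mono abs_val_of_nat_le[OF av] T_le vec_norm_nonneg[OF av])
    also have "\<dots> = (\<Sum>k=1..N. real (Suc k) * u ^ k) * ?n y"
      by (simp add: sum_distrib_right mult.assoc)
    also have "\<dots> \<le> (1 / (1 - u)\<^sup>2 - 1) * ?n y"
      by (intro mult_right_mono sum_mult_power_le u0 u vec_norm_nonneg av)
    finally have "?n (y - B *v (J *v y)) \<le> (1 / (1 - u)\<^sup>2 - 1) * ?n y"
      unfolding J by (simp add: vec_norm_minus[OF av])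
    moreover have "?n y \<le> ?n (B *v (J *v y)) + ?n (y - B *v (J *v y))"
      using vec_norm_triangle[OF av, of "B *v (J *v y)" "y - B *v (J *v y)"] by simp
    ultimately show ?thesis
      by (simp add: algebra_simps)
  qed
  have psi: "2 - 1 / (1 - u)\<^sup>2 = (1 - 4 * u + 2 * u\<^sup>2) / (1 - u)\<^sup>2"
  proof -
    have eq: "1 - 4 * u + 2 * u\<^sup>2 = 2 * (1 - u)\<^sup>2 - 1"
      by (simp add: power2_eq_square algebra_simps)
    show ?thesis
      unfolding eq using u(1) by (simp add: diff_divide_distrib)
  qed
  have "y = 0" if "J *v y = 0" for y
  proof -
    have "(2 - 1 / (1 - u)\<^sup>2) * ?n y \<le> 0"
      using lower[of y] unfolding that by (simp only: matrix_vector_mult_0_right vec_norm_0[OF av])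
    moreover have "2 - 1 / (1 - u)\<^sup>2 > 0"
      unfolding psi using u by simp
    ultimately have "?n y = 0"
      using vec_norm_nonneg[OF av, of y] by (simp add: mult_le_0_iff)
    then show ?thesis
      by (simp add: vec_norm_eq_0_iff[OF av])
  qed
  then show inv: "invertible (jacobian F z)"
    unfolding J_def[symmetric] invertible_left_inverse matrix_left_invertible_ker by blast
  define y where "y = newton F z - \<zeta>"
  \<comment> \<open>The new error is \<open>h\<close> minus the Newton correction; applying
    \<open>J\<close> removes the inverse.\<close>
  have "J *v y = J *v h - system_eval F z"
    by (simp add: y_def newton_def h_def J_def matrix_vector_mult_diff_distrib matrix_vector_mul_assoc
        matrix_inv_mult[OF inv])
  \<comment> \<open>The leading \<open>h\<close> cancels and the coefficients subtract as
    \<open>(k + 1) - 1 = k\<close>.\<close>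
  then have "B *v (J *v y) = (\<Sum>k=1..N. of_nat k *s T (replicate k h @ [h]))"
    by (simp add: matrix_vector_mult_diff_distrib J E vec.scale_left_distrib sum.distrib)
  then have "?n (B *v (J *v y)) \<le> (\<Sum>k=1..N. ?n (of_nat k *s T (replicate k h @ [h])))"
    by (simp add: vec_norm_sum_le[OF av])
  also have "\<dots> \<le> (\<Sum>k=1..N. real k * (u ^ k * ?n h))"
    by (intro sum_mono)
       (auto simp: vec_norm_scale[OF av] intro!: mult_mono abs_val_of_nat_le[OF av] T_le vec_norm_nonneg[OF av])
  also have "\<dots> = (\<Sum>k=1..N. real k * u ^ k) * ?n h"
    by (simp add: sum_distrib_right mult.assoc)
  also have "\<dots> \<le> u / (1 - u)\<^sup>2 * ?n h"
    by (intro mult_right_mono sum_mult_power_le u0 u vec_norm_nonneg av)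
  finally have "(2 - 1 / (1 - u)\<^sup>2) * ?n y \<le> u / (1 - u)\<^sup>2 * ?n h"
    by (rule order_trans[OF lower])
  then have "(1 - 4 * u + 2 * u\<^sup>2) * ?n y / (1 - u)\<^sup>2 \<le> u * ?n h / (1 - u)\<^sup>2"
    unfolding psi times_divide_eq_left .
  moreover have "(1 - u)\<^sup>2 > 0"
    using u(1) by simp
  ultimately show "(1 - 4 * u + 2 * u\<^sup>2) * vec_norm v (newton F z - \<zeta>) \<le> u * vec_norm v (z - \<zeta>)"
    unfolding divide_le_cancel y_def h_def by blast
qed

text \<open>While \<open>u <= c\<close>, the contraction factor is at most
  \<open>u / (2 * c)\<close>. It is proportional to the current error, hence quadratic
  decay.\<close>

theorem smale_gamma_theorem:
  fixes F :: "('n::finite, 'k::field) mpoly ^ 'n"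
  assumes av: "absolute_value v"
    and char: "\<And>n. n > 0 \<Longrightarrow> of_nat n \<noteq> (0::'k)"
    and zero: "smooth_zero F \<zeta>"
    and le: "vec_norm v (\<zeta> - z) * smale_gamma v F \<zeta> \<le> (3 - sqrt 7) / 2"
  shows "approximate_zero v F \<zeta> z"
proof -
  define c where "c = (3 - sqrt 7) / 2"
  define g where "g = smale_gamma v F \<zeta>"
  define x where "x k = (newton F ^^ k) z" for k
  define d where "d k = vec_norm v (x k - \<zeta>)" for k
  have "sqrt 7 < 3"
    by (rule real_less_lsqrt) auto
  then have c0: "c > 0" by (simp add: c_def)
  have "sqrt 7 > 2"
    by (rule real_less_rsqrt) auto
  then have c_less: "c < 1 / 2" by (simp add: c_def)
  \<comment> \<open>\<open>c\<close> is the smaller root of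
    \<open>2 * x^2 - 6 * x + 1\<close>.\<close>
  have c_eq: "1 - 4 * c + 2 * c\<^sup>2 = 2 * c"
    by (simp add: c_def power2_eq_square field_simps)
  have g0: "g \<ge> 0" and d0: "d k \<ge> 0" for k
    by (simp_all add: g_def d_def smale_gamma_nonneg[OF av] vec_norm_nonneg[OF av])
  have step: "invertible (jacobian F (x k))" "2 * c * d (Suc k) \<le> d k * g * d k"
    if "d k * g \<le> c" for k
  proof -
    let ?u = "d k * g"
    \<comment> \<open>Half the difference of the values of \<open>1 - 4 * x + 2 * x^2\<close> at
      \<open>?u\<close> and at \<open>c\<close>, factored.\<close>
    have "(c - ?u) * (2 - (c + ?u)) \<ge> 0"
      using that c_less by (intro mult_nonneg_nonneg) auto
    then have psi: "1 - 4 * ?u + 2 * ?u\<^sup>2 \<ge> 2 * c"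
      using c_eq by (simp add: power2_eq_square algebra_simps)
    have u: "?u < 1" "0 < 1 - 4 * ?u + 2 * ?u\<^sup>2"
      using that c_less c0 psi by auto
    note contr = newton_contraction[OF av char zero _ u]
    show "invertible (jacobian F (x k))"
      by (rule contr) (simp_all add: d_def g_def)
    have "(1 - 4 * ?u + 2 * ?u\<^sup>2) * vec_norm v (newton F (x k) - \<zeta>) \<le> ?u * vec_norm v (x k - \<zeta>)"
      by (rule contr) (simp_all add: d_def g_def)
    then have "(1 - 4 * ?u + 2 * ?u\<^sup>2) * d (Suc k) \<le> ?u * d k"
      by (simp add: d_def x_def)
    then show "2 * c * d (Suc k) \<le> ?u * d k"
      using mult_right_mono[OF psi d0[of "Suc k"]] by linarith
  qed
  have init: "d 0 * g \<le> c"
    using le by (simp add: d_def x_def g_def c_def vec_norm_minus_commute[OF av])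
  \<comment> \<open>The decay bound keeps the iterate in the range where \<open>step\<close>
    applies.\<close>
  have small: "d k * g \<le> c" if "d k * 2 ^ (2 ^ k - 1) \<le> d 0" for k
  proof -
    have "d k * 1 \<le> d k * 2 ^ (2 ^ k - 1)"
      by (intro mult_left_mono d0) simp
    then have "d k * g \<le> d 0 * g"
      using that g0 by (intro mult_right_mono) linarith+
    with init show ?thesis by linarith
  qed
  \<comment> \<open>Sharper than required, so that the induction closes: the exponents start at 0
    and satisfy \<open>2 * (2^k - 1) + 1 = 2^(k + 1) - 1\<close>.\<close>
  have decay: "d k * 2 ^ (2 ^ k - 1) \<le> d 0" for k
  proof (induction k)
    case (Suc k)
    let ?P = "2 ^ (2 ^ k - 1) :: real"
    \<comment> \<open>The 2 in \<open>2 * c\<close> supplies the extra 1 in the exponent, and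
      \<open>c\<close> cancels against the bound \<open>init\<close>.\<close>
    have "2 * c * d (Suc k) * ?P\<^sup>2 \<le> (d k * g * d k) * ?P\<^sup>2"
      by (intro mult_right_mono step small Suc.IH) simp
    also have "\<dots> = (d k * ?P * g) * (d k * ?P)"
      by (simp add: power2_eq_square)
    also have "\<dots> \<le> (d 0 * g) * d 0"
      by (intro mult_mono mult_right_mono Suc.IH mult_nonneg_nonneg g0 d0) simp_all
    also have "\<dots> \<le> c * d 0"
      by (intro mult_right_mono init d0)
    finally have "c * (d (Suc k) * (2 * ?P\<^sup>2)) \<le> c * d 0"
      by (simp add: mult_ac)
    then have "d (Suc k) * (2 * ?P\<^sup>2) \<le> d 0"
      using c0 by simp
    moreover have "2 * ?P\<^sup>2 = 2 ^ (2 ^ Suc k - 1)"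
    proof -
      have "2 * ?P\<^sup>2 = 2 ^ Suc ((2 ^ k - 1) * 2)"
        by (simp add: power_mult)
      also have "Suc ((2 ^ k - 1) * 2) = 2 ^ Suc k - 1"
        by (cases "2 ^ k :: nat") simp_all
      finally show ?thesis .
    qed
    ultimately show ?case by simp
  qed simp
  have "d k \<le> 1 / 2 ^ (2 ^ (k - 1)) * d 0" if "k \<ge> 1" for k
  proof -
    \<comment> \<open>The required exponent is at most the proved one, with equality at
      \<open>k = 1\<close>.\<close>
    have "(2::nat) ^ (k - 1) \<le> 2 ^ k - 1"
      using that one_le_power[of "2::nat" "k - 1"] by (cases k) auto
    then have "d k * 2 ^ (2 ^ (k - 1)) \<le> d k * 2 ^ (2 ^ k - 1)"
      by (intro mult_left_mono power_increasing d0) auto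
    with decay[of k] have "d k * 2 ^ (2 ^ (k - 1)) \<le> d 0" by linarith
    then show ?thesis by (simp add: field_simps)
  qed
  moreover have inv: "invertible (jacobian F (x k))" for k
    using step small decay by blast
  ultimately show ?thesis
    unfolding approximate_zero_def using zero inv[of 0] by (auto simp: d_def x_def)
qed

subsection \<open>Passing to the completion\<close>

text \<open>\<open>vec_norm\<close> chooses between maximum and Hermitian norm by this property, so
  both fields must agree on it. It reaches the completion by density.\<close>

lemma is_completion_non_archimedean_iff:
  assumes "is_completion v e w"
  shows "non_archimedean w \<longleftrightarrow> non_archimedean v"
proof
  assume "non_archimedean w"
  then show "non_archimedean v"
    using assms unfolding is_completion_def non_archimedean_def by metis
next
  assume na: "non_archimedean v"
  have av: "absolute_value w" and e_add: "\<And>x y. e (x + y) = e x + e y" and we: "\<And>x. w (e x) = v x"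
    using assms by (auto simp: is_completion_def)
  interpret Metric_space UNIV "\<lambda>x y. w (x - y)"
  proof
    fix x y z
    show "w (x - y) = w (y - x)"
      using abs_val_minus[OF av, of "x - y"] by simp
    show "w (x - z) \<le> w (x - y) + w (y - z)"
      using abs_val_triangle[OF av, of "x - y" "y - z"] by simp
  qed (simp_all add: abs_val_nonneg[OF av] abs_val_eq_0_iff[OF av])
  have dense: "\<exists>a. w (x - e a) < r" if "r > 0" for x r
  proof -
    have "mtopology closure_of range e = UNIV"
      using assms by (simp add: is_completion_def)
    then have "x \<in> mtopology closure_of range e" by simp
    then have "\<exists>y\<in>range e. y \<in> mball x r"
      using that unfolding metric_closure_of by blast
    then show ?thesis
      unfolding in_mball by blast
  qed
  show "non_archimedean w"
    unfolding non_archimedean_def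
  proof (intro allI, rule field_le_epsilon)
    fix x y and r :: real
    assume "r > 0"
    \<comment> \<open>Two approximation errors below \<open>r / 4\<close>, and one more from
      comparing \<open>w (e a)\<close>, \<open>w (e b)\<close> with \<open>w x\<close>,
      \<open>w y\<close>, total less than \<open>r\<close>.\<close>
    then obtain a b where a: "w (x - e a) < r / 4" and b: "w (y - e b) < r / 4"
      using dense[of "r / 4"] by fastforce
    have "w (x + y) \<le> w (x - e a + (y - e b)) + w (e a + e b)"
      using abs_val_triangle[OF av, of "x - e a + (y - e b)" "e a + e b"] by simp
    also have "w (x - e a + (y - e b)) \<le> w (x - e a) + w (y - e b)"
      by (rule abs_val_triangle[OF av])
    also have "w (e a + e b) \<le> max (w (e a)) (w (e b))"
      using na by (simp add: non_archimedean_def flip: e_add add: we)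
    finally have 1: "w (x + y) \<le> w (x - e a) + w (y - e b) + max (w (e a)) (w (e b))" by simp
    have "w (e a) \<le> w x + w (x - e a)" "w (e b) \<le> w y + w (y - e b)"
      using abs_val_triangle[OF av, of x "e a - x"] abs_val_triangle[OF av, of y "e b - y"]
        commute[of x "e a"] commute[of y "e b"] by simp_all
    with 1 a b \<open>r > 0\<close> show "w (x + y) \<le> max (w x) (w y) + r"
      unfolding max_def by (simp split: if_splits)
  qed
qed

lemma extend_vec_nth [simp]: "extend_vec e x $ i = e (x $ i)"
  by (simp add: extend_vec_def)

lemma is_completion_vec_norm:
  assumes "is_completion v e w"
  shows "vec_norm w (extend_vec e x) = vec_norm v x"
  using assms is_completion_non_archimedean_iff[OF assms]
  by (simp add: vec_norm_def is_completion_def)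

definition extend_mat :: "('k \<Rightarrow> 'c) \<Rightarrow> 'k ^ 'n ^ 'm \<Rightarrow> 'c ^ 'n ^ 'm" where
  "extend_mat e M = (\<chi> i j. e (M $ i $ j))"

section \<open>Transport of the algebra along a field embedding\<close>

locale field_embedding =
  fixes e :: "'k::field \<Rightarrow> 'c::field"
  assumes e_1: "e 1 = 1"
    and e_add: "\<And>x y. e (x + y) = e x + e y"
    and e_mult: "\<And>x y. e (x * y) = e x * e y"
begin

lemma hom_0: "e 0 = 0"
  using e_add[of 0 0] by (metis add_0_right add_left_cancel)

lemma hom_diff: "e (x - y) = e x - e y"
  using e_add[of "x - y" y] by simp

lemma hom_sum: "e (\<Sum>a\<in>A. f a) = (\<Sum>a\<in>A. e (f a))"
  by (induction A rule: infinite_finite_induct) (simp_all add: hom_0 e_add)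

lemma hom_prod: "e (\<Prod>a\<in>A. f a) = (\<Prod>a\<in>A. e (f a))"
  by (induction A rule: infinite_finite_induct) (simp_all add: e_1 e_mult)

lemma hom_power: "e (x ^ n) = e x ^ n"
  by (induction n) (simp_all add: e_1 e_mult)

lemma hom_of_nat: "e (of_nat n) = of_nat n"
  by (induction n) (simp_all add: hom_0 e_1 e_add)

text \<open>A nonzero \<open>x\<close> is a unit, and units go to units. This injectivity preserves
  the keys of polynomials.\<close>

lemma hom_eq_0_iff: "e x = 0 \<longleftrightarrow> x = 0"
proof
  assume "e x = 0"
  then have "e (x * inverse x) = 0" by (simp add: e_mult)
  then show "x = 0" using e_1 by (cases "x = 0") auto
qed (simp add: hom_0)

lemma extend_vec_diff: "extend_vec e (x - y) = extend_vec e x - extend_vec e y"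
  by (simp add: vec_eq_iff hom_diff)

text \<open>\<open>Poly_Mapping.map\<close> skips zero coefficients, which is harmless as
  \<open>e\<close> sends 0 to 0.\<close>

lemma lookup_map_hom: "Poly_Mapping.lookup (Poly_Mapping.map e p) m = e (Poly_Mapping.lookup p m)"
  by (simp add: map.rep_eq when_def hom_0)

lemma keys_map_hom: "Poly_Mapping.keys (Poly_Mapping.map e p) = Poly_Mapping.keys p"
  by (auto simp: in_keys_iff lookup_map_hom hom_eq_0_iff)

lemma mpoly_eval_map_hom: "mpoly_eval (Poly_Mapping.map e p) (extend_vec e x) = e (mpoly_eval p x)"
  by (simp add: mpoly_eval_def keys_map_hom lookup_map_hom hom_sum hom_prod hom_power e_mult)

lemma mpoly_pderiv_map_hom: "mpoly_pderiv j (Poly_Mapping.map e p) = Poly_Mapping.map e (mpoly_pderiv j p)"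
  by (rule poly_mapping_eqI)
     (auto simp: mpoly_pderiv_def keys_map_hom lookup_map_hom lookup_sum lookup_single hom_sum hom_of_nat
       e_mult when_def hom_0 intro!: sum.cong)

lemma system_eval_extend: "system_eval (extend_system e F) (extend_vec e x) = extend_vec e (system_eval F x)"
  by (simp add: vec_eq_iff system_eval_def extend_system_def mpoly_eval_map_hom)

lemma jacobian_extend: "jacobian (extend_system e F) (extend_vec e x) = extend_mat e (jacobian F x)"
  by (simp add: vec_eq_iff jacobian_def extend_system_def mpoly_pderiv_map_hom mpoly_eval_map_hom
      extend_mat_def)

lemma extend_mat_mult_vec: "extend_mat e M *v extend_vec e x = extend_vec e (M *v x)"
  by (simp add: vec_eq_iff matrix_vector_mult_def extend_mat_def hom_sum e_mult)

lemma extend_mat_mult: "extend_mat e M ** extend_mat e N = extend_mat e (M ** N)"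
  by (simp add: vec_eq_iff matrix_matrix_mult_def extend_mat_def hom_sum e_mult)

lemma extend_mat_1: "extend_mat e (mat 1) = mat 1"
  by (simp add: vec_eq_iff mat_def extend_mat_def e_1 hom_0)

text \<open>The entries of an inverse over the larger field are not known to lie in the image of
  \<open>e\<close>, so the converse goes through trivial kernels.\<close>

lemma invertible_extend_mat_iff:
  fixes M :: "'k ^ 'n ^ 'n"
  shows "invertible (extend_mat e M) \<longleftrightarrow> invertible M"
proof
  assume "invertible M"
  then show "invertible (extend_mat e M)"
    unfolding invertible_def by (metis extend_mat_mult extend_mat_1)
next
  assume inv: "invertible (extend_mat e M)"
  have "x = 0" if "M *v x = 0" for x
  proof -
    have "extend_mat e M *v extend_vec e x = extend_mat e M *v 0"
      using that by (simp add: extend_mat_mult_vec vec_eq_iff hom_0)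
    then have "extend_vec e x = 0"
      using inv unfolding invertible_left_inverse matrix_left_invertible_ker by simp
    then show ?thesis
      by (simp add: vec_eq_iff hom_eq_0_iff)
  qed
  then show "invertible M"
    unfolding invertible_left_inverse matrix_left_invertible_ker by blast
qed

lemma matrix_inv_extend_mat:
  fixes M :: "'k ^ 'n ^ 'n"
  assumes "invertible M"
  shows "matrix_inv (extend_mat e M) = extend_mat e (matrix_inv M)"
proof -
  have "extend_mat e (matrix_inv M) ** extend_mat e M = mat 1"
    using assms by (simp add: extend_mat_mult matrix_inv_mult extend_mat_1)
  moreover have "extend_mat e M ** matrix_inv (extend_mat e M) = mat 1"
    using assms by (intro matrix_inv_mult) (simp add: invertible_extend_mat_iff)
  ultimately show ?thesis
    by (metis matrix_mul_assoc matrix_mul_lid matrix_mul_rid)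
qed

text \<open>Invertibility is assumed because \<open>matrix_inv\<close> of a singular matrix is an
  arbitrary choice.\<close>

lemma newton_extend:
  assumes "invertible (jacobian F x)"
  shows "newton (extend_system e F) (extend_vec e x) = extend_vec e (newton F x)"
  using assms
  by (simp add: newton_def jacobian_extend system_eval_extend matrix_inv_extend_mat extend_mat_mult_vec
      extend_vec_diff)

lemma smooth_zero_extend_iff:
  "smooth_zero (extend_system e F) (extend_vec e x) \<longleftrightarrow> smooth_zero F x"
  by (auto simp: smooth_zero_def jacobian_extend system_eval_extend invertible_extend_mat_iff
      vec_eq_iff hom_eq_0_iff)

lemma approximate_zero_extend:
  assumes norm: "\<And>x :: 'k ^ 'n. vec_norm w (extend_vec e x) = vec_norm v x"
    and approx: "approximate_zero w (extend_system e F) (extend_vec e \<zeta>) (extend_vec e (z :: 'k ^ 'n::finite))"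
  shows "approximate_zero v F \<zeta> z"
proof -
  let ?F = "extend_system e F" and ?z = "extend_vec e z"
  have inv: "invertible (jacobian ?F ((newton ?F ^^ k) ?z))" for k
    using approx by (cases k) (auto simp: approximate_zero_def)
  \<comment> \<open>Each step uses \<open>newton_extend\<close>, so invertibility over the
    completion is pulled back at every iterate.\<close>
  have iter: "(newton ?F ^^ k) ?z = extend_vec e ((newton F ^^ k) z)" for k
  proof (induction k)
    case (Suc k)
    have "invertible (jacobian F ((newton F ^^ k) z))"
      using inv[of k] by (simp add: Suc.IH jacobian_extend invertible_extend_mat_iff)
    then show ?case
      by (simp add: Suc.IH newton_extend)
  qed simp
  show ?thesis
    using approx
    by (simp add: approximate_zero_def iter smooth_zero_extend_iff jacobian_extend
        invertible_extend_mat_iff norm flip: extend_vec_diff)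
qed

end

theorem theorem2:
  fixes F :: "('n::finite, 'k::field_char_0) mpoly ^ 'n"
    and \<zeta> z :: "'k ^ 'n"
    and v :: "'k \<Rightarrow> real"
    and e :: "'k \<Rightarrow> 'c::field"
    and w :: "'c \<Rightarrow> real"
  assumes "number_field TYPE('k)"
    and "\<exists>i::'k. i ^ 2 = - 1"
    and "smooth_zero F \<zeta>"
    and "v \<in> standard_absolute_values"
    and "is_completion v e w"
    and "vec_norm v (\<zeta> - z) * smale_gamma w (extend_system e F) (extend_vec e \<zeta>) \<le> (3 - sqrt 7) / 2"
  shows "approximate_zero v F \<zeta> z"
proof -
  have av: "absolute_value w"
    using assms(5) by (simp add: is_completion_def)
  interpret field_embedding e
    using assms(5) by unfold_locales (auto simp: is_completion_def)
  note norm = is_completion_vec_norm[OF assms(5)]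
  \<comment> \<open>Injectivity of \<open>e\<close> carries characteristic 0 over to the
    completion.\<close>
  have char: "of_nat n \<noteq> (0::'c)" if "n > 0" for n
    using hom_eq_0_iff[of "of_nat n"] that by (simp add: hom_of_nat)
  have "vec_norm w (extend_vec e \<zeta> - extend_vec e z) * smale_gamma w (extend_system e F) (extend_vec e \<zeta>)
      \<le> (3 - sqrt 7) / 2"
    using assms(6) by (simp add: norm flip: extend_vec_diff)
  then have "approximate_zero w (extend_system e F) (extend_vec e \<zeta>) (extend_vec e z)"
    using assms(3) by (intro smale_gamma_theorem av char) (simp_all add: smooth_zero_extend_iff)
  with norm show ?thesis
    by (rule approximate_zero_extend)
qed

end
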